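(* Let $(G,S)$ be a Coxeter system, where $G$ is infinite and indecomposable and $S$ is finite. Let $H\subseteq G$ be a reflection subgroup of finite index. Then any set of reflections generating $H$ contains at least $|S|$ elements.
   Context: A Coxeter system $(G,S)$: $S$ finite, $G=\langle S\mid (s_is_j)^{m_{ij}}=1\rangle$ with $m_{ii}=1$, $m_{ij}\in\{2,\dots,\infty\}$ for $i\ne j$. $G$ is indecomposable if $S$ cannot be written as a disjoint union of two nonempty subsets $S_1,S_2$ with every element of $S_1$ commuting with every element of $S_2$. A reflection in $G$ is an element conjugate to some element of $S$; a reflection subgroup is a subgroup generated by reflections. *)

theory Defs
  imports "HOL-Algebra.Algebra"
begin

definition word_eval :: "('a, 'b) monoid_scheme \<Rightarrow> 'a list \<Rightarrow> 'a" where
  "word_eval G w = foldr (\<lambda>x a. x \<otimes>\<^bsub>G\<^esub> a) w \<one>\<^bsub>G\<^esub>"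

(* Coxeter matrix encoded as m :: 'a => 'a => nat, with 0 standing for infinity.
   cox_equiv m: the congruence on words generated by deleting/inserting the
   relators (s t)^{m s t} (for m s t finite); since m s s = 1 this includes s s. *)
inductive cox_equiv :: "('a \<Rightarrow> 'a \<Rightarrow> nat) \<Rightarrow> 'a set \<Rightarrow> 'a list \<Rightarrow> 'a list \<Rightarrow> bool"
  for m S where
  refl: "cox_equiv m S w w"
| sym: "cox_equiv m S u v \<Longrightarrow> cox_equiv m S v u"
| trans: "cox_equiv m S u v \<Longrightarrow> cox_equiv m S v w \<Longrightarrow> cox_equiv m S u w"
| rel: "s \<in> S \<Longrightarrow> t \<in> S \<Longrightarrow> m s t \<noteq> 0 \<Longrightarrow>
        cox_equiv m S (u @ concat (replicate (m s t) [s, t]) @ v) (u @ v)"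

(* (G,S) is a Coxeter system: G is presented by generators S and relations
   (s t)^{m s t} = 1, with m s s = 1 and m s t in {2,3,...} \<union> {\<infinity>} (0 = \<infinity>) for s \<noteq> t.
   Presentation: S generates G, the relations hold in G, and every word over S
   that evaluates to 1 in G is a consequence of the relations. *)
definition coxeter_system :: "('a, 'b) monoid_scheme \<Rightarrow> 'a set \<Rightarrow> bool" where
  "coxeter_system G S \<longleftrightarrow>
     group G \<and> S \<subseteq> carrier G \<and> generate G S = carrier G \<and>
     (\<exists>m :: 'a \<Rightarrow> 'a \<Rightarrow> nat.
        (\<forall>s\<in>S. m s s = 1) \<and>
        (\<forall>s\<in>S. \<forall>t\<in>S. s \<noteq> t \<longrightarrow> m s t = m t s \<and> m s t \<noteq> 1) \<and>
        (\<forall>s\<in>S. \<forall>t\<in>S. m s t \<noteq> 0 \<longrightarrow> (s \<otimes>\<^bsub>G\<^esub> t) [^]\<^bsub>G\<^esub> (m s t) = \<one>\<^bsub>G\<^esub>) \<and>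
        (\<forall>w \<in> lists S. word_eval G w = \<one>\<^bsub>G\<^esub> \<longrightarrow> cox_equiv m S w []))"

definition coxeter_indecomposable :: "('a, 'b) monoid_scheme \<Rightarrow> 'a set \<Rightarrow> bool" where
  "coxeter_indecomposable G S \<longleftrightarrow>
     \<not> (\<exists>S1 S2. S1 \<noteq> {} \<and> S2 \<noteq> {} \<and> S1 \<inter> S2 = {} \<and> S1 \<union> S2 = S \<and>
            (\<forall>a\<in>S1. \<forall>b\<in>S2. a \<otimes>\<^bsub>G\<^esub> b = b \<otimes>\<^bsub>G\<^esub> a))"

definition reflections :: "('a, 'b) monoid_scheme \<Rightarrow> 'a set \<Rightarrow> 'a set" where
  "reflections G S = {g \<otimes>\<^bsub>G\<^esub> s \<otimes>\<^bsub>G\<^esub> inv\<^bsub>G\<^esub> g | g s. g \<in> carrier G \<and> s \<in> S}"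

definition reflection_subgroup :: "('a, 'b) monoid_scheme \<Rightarrow> 'a set \<Rightarrow> 'a set \<Rightarrow> bool" where
  "reflection_subgroup G S H \<longleftrightarrow> (\<exists>R \<subseteq> reflections G S. H = generate G R)"

end

theory Submission
  imports Defs Complex_Main
begin

text \<open>Let \<open>V = \<real>\<^sup>S\<close> be the geometric representation with its bilinear form \<open>B\<close>, and suppose that a
  set \<open>R\<close> of fewer than \<open>|S|\<close> reflections, with roots \<open>\<beta>\<^sub>r\<close>, generates a subgroup \<open>H\<close> of finite index.
  Its normal core \<open>N\<close> is nontrivial because \<open>G\<close> is infinite, so \<open>N\<close> acts nontrivially on \<open>V\<close>.

  Some nonzero functional kills all \<open>\<beta>\<^sub>r\<close> and is therefore \<open>H\<close>-invariant. As proper \<open>G\<close>-invariant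
  subspaces lie in the radical of \<open>B\<close>, it follows that \<open>N\<close> acts trivially modulo the radical. Hence
  \<open>G\<close> acts on \<open>V / rad B\<close> through a finite group, averaging shows that \<open>B\<close> is positive
  semidefinite, and by Perron--Frobenius every nonzero vector of the radical has only nonzero
  coordinates. Let \<open>\<delta> = n \<alpha>\<^sub>z - \<alpha>\<^sub>z \<noteq> 0\<close> with \<open>n \<in> N\<close>, a vector of the radical.

  Counting equations again, there is \<open>u \<noteq> 0\<close> such that the functional
  \<open>v \<mapsto> B(u, v) + u\<^sub>z v\<^sub>z\<close> kills all \<open>\<beta>\<^sub>r\<close>. Being \<open>H\<close>-invariant it also kills \<open>\<delta>\<close>, which forces
  \<open>u\<^sub>z = 0\<close>. Thus \<open>u\<close> is not in the radical, and it is orthogonal to all \<open>\<beta>\<^sub>r\<close>, so \<open>N\<close> fixes \<open>u\<close> and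
  then all of its \<open>G\<close>-orbit, which spans \<open>V\<close>: a contradiction.\<close>

section \<open>Linear systems and finite-index preliminaries\<close>

lemma homogeneous_system_nonzero_solution:
  fixes a :: "'r \<Rightarrow> 'a \<Rightarrow> real"
  assumes "finite R" "finite S" "card R < card S"
  shows "\<exists>x. (\<exists>s\<in>S. x s \<noteq> 0) \<and> (\<forall>r\<in>R. (\<Sum>s\<in>S. a r s * x s) = 0)"
  using assms
proof (induction R arbitrary: S a rule: finite_induct)
  case empty
  then have "S \<noteq> {}" by auto
  then show ?case by (intro exI[of _ "\<lambda>_. 1"]) auto
next
  case (insert q R)
  show ?case
  proof (cases "\<forall>s\<in>S. a q s = 0")
    case True
    have "card R < card S" using insert.prems insert.hyps by simp
    from insert.IH[OF insert.prems(1) this, of a] True show ?thesis by auto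
  next
    case False
    then obtain p where p: "p \<in> S" "a q p \<noteq> 0" by auto
    \<comment> \<open>Gaussian elimination: row \<open>q\<close> clears the unknown \<open>p\<close>
      from the other rows, and \<open>y\<close> will be the back substitution.\<close>
    define c where "c = (\<lambda>r s. a r s - a r p * a q s / a q p)"
    have fin: "finite (S - {p})" using insert.prems by simp
    have "card R < card (S - {p})" using insert p by simp
    from insert.IH[OF fin this, of c] obtain x where
      x: "\<exists>s\<in>S-{p}. x s \<noteq> 0" "\<And>r. r \<in> R \<Longrightarrow> (\<Sum>s\<in>S-{p}. c r s * x s) = 0" by auto
    define y where "y = x(p := - (\<Sum>s\<in>S-{p}. a q s * x s) / a q p)"
    have split: "(\<Sum>s\<in>S. a r s * y s) = a r p * y p + (\<Sum>s\<in>S-{p}. a r s * x s)" for r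
    proof -
      have "(\<Sum>s\<in>S-{p}. a r s * y s) = (\<Sum>s\<in>S-{p}. a r s * x s)"
        by (rule sum.cong) (auto simp: y_def)
      then show ?thesis using sum.remove[OF insert.prems(1) p(1), of "\<lambda>s. a r s * y s"] by simp
    qed
    have "(\<Sum>s\<in>S. a r s * y s) = 0" if "r \<in> insert q R" for r
    proof (cases "r = q")
      case True
      then show ?thesis using split[of q] p(2) by (simp add: y_def)
    next
      case False
      then have "r \<in> R" using that by simp
      have "(\<Sum>s\<in>S-{p}. c r s * x s)
          = (\<Sum>s\<in>S-{p}. a r s * x s) - a r p / a q p * (\<Sum>s\<in>S-{p}. a q s * x s)"
        by (simp add: c_def algebra_simps sum_subtractf sum_distrib_left)
      then show ?thesis using split[of r] x(2)[OF \<open>r \<in> R\<close>] by (simp add: y_def)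
    qed
    moreover have "\<exists>s\<in>S. y s \<noteq> 0" using x(1) by (auto simp: y_def)
    ultimately show ?thesis by blast
  qed
qed

lemma finite_image_factor:
  assumes "finite (f ` A)" "\<And>x y. \<lbrakk>x \<in> A; y \<in> A; f x = f y\<rbrakk> \<Longrightarrow> k x = k y"
  shows "finite (k ` A)"
proof (rule finite_subset)
  show "k ` A \<subseteq> (\<lambda>y. k (inv_into A f y)) ` f ` A"
  proof
    fix z assume "z \<in> k ` A"
    then obtain x where x: "x \<in> A" "z = k x" by blast
    then have "z = k (inv_into A f (f x))"
      using assms(2)[OF x(1) inv_into_into[of "f x" f A]] by (simp add: f_inv_into_f)
    then show "z \<in> (\<lambda>y. k (inv_into A f y)) ` f ` A" using x(1) by blast
  qed
qed (use assms(1) in simp)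

text \<open>\<open>F g\<close> is the map that right multiplication by \<open>g\<close> induces on
  the cosets of \<open>H\<close>. There are finitely many such maps, and the free \<open>k\<close>
  says that elements of one fibre differ by the normal core; the quotient by the core is never
  formed.\<close>

lemma (in group) finite_index_core_fibres:
  assumes "subgroup H G" "finite (rcosets H)"
  obtains F :: "'a \<Rightarrow> 'a set \<Rightarrow> 'a set" where "finite (F ` carrier G)"
    "\<And>g h k. \<lbrakk>g \<in> carrier G; h \<in> carrier G; k \<in> carrier G; F g = F h\<rbrakk>
       \<Longrightarrow> k \<otimes> (g \<otimes> inv h) \<otimes> inv k \<in> H"
proof
  define F where "F = (\<lambda>g. restrict (\<lambda>C. C #> g) (rcosets H))"
  have HG: "H \<subseteq> carrier G" using assms(1) by (rule subgroup.subset)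
  have "C #> g \<in> rcosets H" if "C \<in> rcosets H" "g \<in> carrier G" for C g
    using that HG by (auto simp: RCOSETS_def coset_mult_assoc)
  then have "F ` carrier G \<subseteq> rcosets H \<rightarrow>\<^sub>E rcosets H"
    by (auto simp: F_def)
  then show "finite (F ` carrier G)"
    using assms(2) by (meson finite_PiE finite_subset)
  fix g h k assume *: "g \<in> carrier G" "h \<in> carrier G" "k \<in> carrier G" "F g = F h"
  have "H #> k \<in> rcosets H" using HG * by (auto simp: RCOSETS_def)
  then have "H #> k #> g = H #> k #> h" using *(4) by (metis F_def restrict_apply')
  then have "H #> (k \<otimes> g) = H #> (k \<otimes> h)" using HG * by (simp add: coset_mult_assoc)
  then have "k \<otimes> g \<in> H #> (k \<otimes> h)" using rcos_self[of "k \<otimes> g" H] assms(1) * by simp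
  then obtain a where a: "a \<in> H" "k \<otimes> g = a \<otimes> (k \<otimes> h)" by (auto simp: r_coset_def)
  then have "k \<otimes> g \<otimes> inv (k \<otimes> h) = a" using HG * by (simp add: m_assoc subset_eq)
  then have "k \<otimes> g \<otimes> inv (k \<otimes> h) \<in> H" using a by simp
  then show "k \<otimes> (g \<otimes> inv h) \<otimes> inv k \<in> H"
    using * by (simp add: inv_mult_group m_assoc)
qed

section \<open>The geometric representation\<close>

text \<open>Vectors of \<open>\<real>\<^sup>S\<close> are modelled as functions on the whole type; coordinates outside \<open>S\<close>
  are ignored by the bilinear form and left unchanged by the reflections.\<close>

definition lin_comb :: "real \<Rightarrow> ('a \<Rightarrow> real) \<Rightarrow> real \<Rightarrow> ('a \<Rightarrow> real) \<Rightarrow> 'a \<Rightarrow> real" where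
  "lin_comb a u c v = (\<lambda>x. a * u x + c * v x)"

definition simple_root :: "'a \<Rightarrow> 'a \<Rightarrow> real" where
  "simple_root s = (\<lambda>x. of_bool (x = s))"

locale coxeter_form =
  fixes S :: "'a set" and b :: "'a \<Rightarrow> 'a \<Rightarrow> real"
  assumes finite_S: "finite S"
    and b_sym: "s \<in> S \<Longrightarrow> t \<in> S \<Longrightarrow> b s t = b t s"
    and b_diag: "s \<in> S \<Longrightarrow> b s s = 1"
    and b_nonpos: "s \<in> S \<Longrightarrow> t \<in> S \<Longrightarrow> s \<noteq> t \<Longrightarrow> b s t \<le> 0"
begin

text \<open>B(v, \<alpha>) for the simple root \<alpha> of \<open>s\<close>; the vanishing of all
  these values defines the radical.\<close>

definition pairing :: "('a \<Rightarrow> real) \<Rightarrow> 'a \<Rightarrow> real" where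
  "pairing v s = (\<Sum>t\<in>S. v t * b t s)"

definition form :: "('a \<Rightarrow> real) \<Rightarrow> ('a \<Rightarrow> real) \<Rightarrow> real" where
  "form u v = (\<Sum>s\<in>S. pairing u s * v s)"

definition reflect :: "'a \<Rightarrow> ('a \<Rightarrow> real) \<Rightarrow> 'a \<Rightarrow> real" where
  "reflect s v = lin_comb 1 v (- 2 * pairing v s) (simple_root s)"

lemma pairing_lin_comb [simp]:
  "pairing (lin_comb a u c v) s = a * pairing u s + c * pairing v s"
  by (simp add: pairing_def lin_comb_def sum_distrib_left distrib_right sum.distrib mult.assoc)

lemma pairing_simple_root [simp]: "t \<in> S \<Longrightarrow> pairing (simple_root t) s = b t s"
  using finite_S by (simp add: pairing_def simple_root_def of_bool_def if_distrib if_distribR cong: if_cong)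

lemma form_simple_root_right [simp]: "s \<in> S \<Longrightarrow> form u (simple_root s) = pairing u s"
  using finite_S by (simp add: form_def simple_root_def of_bool_def if_distrib cong: if_cong)

lemma form_sym: "form u v = form v u"
proof -
  have "form u v = (\<Sum>s\<in>S. \<Sum>t\<in>S. u t * b t s * v s)"
    by (simp add: form_def pairing_def sum_distrib_right)
  also have "\<dots> = (\<Sum>t\<in>S. \<Sum>s\<in>S. u t * b t s * v s)" by (rule sum.swap)
  also have "\<dots> = (\<Sum>t\<in>S. \<Sum>s\<in>S. v s * b s t * u t)"
    by (intro sum.cong) (auto simp: b_sym)
  also have "\<dots> = form v u" by (simp add: form_def pairing_def sum_distrib_right)
  finally show ?thesis .
qed

lemma form_simple_root_left [simp]: "s \<in> S \<Longrightarrow> form (simple_root s) u = pairing u s"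
  by (simp add: form_sym[of "simple_root s"])

lemma form_lin_comb_right [simp]:
  "form w (lin_comb a u c v) = a * form w u + c * form w v"
  by (simp add: form_def lin_comb_def sum_distrib_left distrib_left sum.distrib mult_ac)

lemma form_lin_comb_left [simp]:
  "form (lin_comb a u c v) w = a * form u w + c * form v w"
  by (simp add: form_sym[of _ w])

lemma form_reflect: "s \<in> S \<Longrightarrow> form (reflect s u) (reflect s v) = form u v"
  by (simp add: reflect_def b_diag algebra_simps)

lemma reflect_lin_comb:
  "reflect s (lin_comb a u c v) = lin_comb a (reflect s u) c (reflect s v)"
  by (simp add: reflect_def) (simp add: lin_comb_def algebra_simps)

lemma reflect_simple_root_self:
  "s \<in> S \<Longrightarrow> reflect s (simple_root s) = lin_comb (-1) (simple_root s) 0 (simple_root s)"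
  by (auto simp: reflect_def lin_comb_def b_diag)

lemma reflect_outside: "s \<in> S \<Longrightarrow> x \<notin> S \<Longrightarrow> reflect s v x = v x"
  by (auto simp: reflect_def lin_comb_def simple_root_def)

lemma reflect_reflect: "s \<in> S \<Longrightarrow> reflect s (reflect s v) = v"
  by (auto simp: reflect_def b_diag) (auto simp: lin_comb_def)

end

text \<open>Connectedness of the Coxeter graph as an induction principle: a property that passes to
  neighbours holds on all of \<open>S\<close> once it holds somewhere.\<close>

locale connected_coxeter_form = coxeter_form S b for S :: "'a set" and b +
  assumes connected: "\<lbrakk>C \<subseteq> S; C \<noteq> {}; \<And>s t. \<lbrakk>s \<in> C; t \<in> S; b s t \<noteq> 0\<rbrakk> \<Longrightarrow> t \<in> C\<rbrakk> \<Longrightarrow> C = S"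
begin

text \<open>Moving \<open>v\<close> by minus its pairing along the simple root lowers the form from
  0 to minus the square of the pairing.\<close>

lemma pairing_eq_0_of_form_eq_0:
  assumes psd: "\<And>v. form v v \<ge> 0" and "form v v = 0" "s \<in> S"
  shows "pairing v s = 0"
proof -
  let ?p = "pairing v s"
  have "0 \<le> form (lin_comb 1 v (- ?p) (simple_root s)) (lin_comb 1 v (- ?p) (simple_root s))"
    by (rule psd)
  also have "\<dots> = - (?p * ?p)" using assms by (simp add: b_diag algebra_simps)
  finally show ?thesis by (simp add: mult_le_0_iff) (auto simp: mult_le_0_iff)
qed

text \<open>The Perron--Frobenius argument: replacing the coordinates by their absolute values does
  not increase the form.\<close>

lemma radical_coordinates_nonzero:
  assumes psd: "\<And>v. form v v \<ge> 0" and rad: "\<And>s. s \<in> S \<Longrightarrow> pairing z s = 0"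
    and "x \<in> S" "z x \<noteq> 0" "y \<in> S"
  shows "z y \<noteq> 0"
proof -
  define a where "a = (\<lambda>s. \<bar>z s\<bar>)"
  have "form a a \<le> form z z"
    unfolding form_def pairing_def sum_distrib_right
  proof (intro sum_mono)
    fix s t assume "s \<in> S" "t \<in> S"
    show "a t * b t s * a s \<le> z t * b t s * z s"
    proof (cases "s = t")
      case True then show ?thesis by (simp add: a_def mult.commute mult.left_commute)
    next
      case False
      then have "b t s \<le> 0" using b_nonpos \<open>s \<in> S\<close> \<open>t \<in> S\<close> by auto
      moreover have "z t * z s \<le> a t * a s" by (simp add: a_def flip: abs_mult)
      ultimately show ?thesis
        using mult_right_mono_neg[of "z t * z s" "a t * a s" "b t s"] by (simp add: mult_ac)
    qed
  qed
  also have "form z z = 0" by (simp add: form_def rad)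
  finally have "form a a = 0" using psd[of a] by simp
  then have rad_a: "pairing a s = 0" if "s \<in> S" for s
    using pairing_eq_0_of_form_eq_0 psd that by blast
  have "{s \<in> S. z s \<noteq> 0} = S"
  proof (rule connected)
    show "{s \<in> S. z s \<noteq> 0} \<noteq> {}" using assms by auto
    fix s t assume *: "s \<in> {s \<in> S. z s \<noteq> 0}" "t \<in> S" "b s t \<noteq> 0"
    show "t \<in> {s \<in> S. z s \<noteq> 0}"
    proof (rule ccontr)
      assume "t \<notin> {s \<in> S. z s \<noteq> 0}"
      then have zt: "z t = 0" using * by simp
      \<comment> \<open>At a zero \<open>t\<close> of \<open>z\<close> the terms of
        \<open>pairing a t\<close> are nonpositive with sum 0, so all vanish and no neighbour of
        \<open>t\<close> lies in the support of \<open>z\<close>.\<close>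
      have "a r * b r t \<le> 0" if "r \<in> S" for r
        using b_nonpos[OF that \<open>t \<in> S\<close>] zt
        by (cases "r = t") (auto simp: a_def mult_nonneg_nonpos)
      then have "\<forall>r\<in>S. - (a r * b r t) = 0"
        using rad_a[OF \<open>t \<in> S\<close>] finite_S
        by (subst sum_nonneg_eq_0_iff[symmetric]) (auto simp: pairing_def sum_negf)
      then show False using * by (auto simp: a_def)
    qed
  qed auto
  then show ?thesis using assms by blast
qed

end

section \<open>Groups acting by isometries of a connected form\<close>

locale geometric_representation = group G + connected_coxeter_form S b
  for G :: "('a, 'c) monoid_scheme" (structure) and S :: "'a set" and b +
  fixes T :: "'a \<Rightarrow> ('a \<Rightarrow> real) \<Rightarrow> 'a \<Rightarrow> real"
  assumes S_carrier: "S \<subseteq> carrier G"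
    and T_one: "T \<one> v = v"
    and T_mult: "g \<in> carrier G \<Longrightarrow> h \<in> carrier G \<Longrightarrow> T (g \<otimes> h) v = T g (T h v)"
    and T_simple: "s \<in> S \<Longrightarrow> T s v = reflect s v"
    and T_lin_comb: "g \<in> carrier G \<Longrightarrow> T g (lin_comb a u c v) = lin_comb a (T g u) c (T g v)"
    and T_form: "g \<in> carrier G \<Longrightarrow> form (T g u) (T g v) = form u v"
    and T_outside: "g \<in> carrier G \<Longrightarrow> x \<notin> S \<Longrightarrow> T g v x = v x"
    and T_faithful: "g \<in> carrier G \<Longrightarrow> (\<And>s. s \<in> S \<Longrightarrow> T g (simple_root s) = simple_root s) \<Longrightarrow> g = \<one>"
begin

lemma T_inv [simp]:
  "g \<in> carrier G \<Longrightarrow> T g (T (inv g) v) = v" "g \<in> carrier G \<Longrightarrow> T (inv g) (T g v) = v"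
  by (simp_all add: T_one flip: T_mult)

lemma T_form_left: "g \<in> carrier G \<Longrightarrow> form (T g u) v = form u (T (inv g) v)"
  using T_form[of g u "T (inv g) v"] by simp

text \<open>\<open>T g\<close> is an isometry, so it carries the reflection in a root to the
  reflection in the image of that root.\<close>

lemma T_conjugate_simple:
  assumes "g \<in> carrier G" "s \<in> S"
  shows "T (g \<otimes> s \<otimes> inv g) v
       = lin_comb 1 v (- 2 * form v (T g (simple_root s))) (T g (simple_root s))"
proof -
  have "pairing (T (inv g) v) s = form v (T g (simple_root s))"
    using T_form_left[OF inv_closed[OF assms(1)], of v "simple_root s"] assms by simp
  then show ?thesis
    using assms S_carrier by (simp add: T_mult T_simple reflect_def T_lin_comb subset_eq)
qed

text \<open>\<open>P\<close> describes a subspace. If \<open>v\<close> pairs nontrivially with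
  \<open>s\<close>, the difference of \<open>v\<close> and \<open>reflect s v\<close> is a nonzero
  multiple of the simple root; connectedness spreads this over \<open>S\<close>.\<close>

lemma invariant_subspace_contains_simple_roots:
  assumes lin: "\<And>a u c v. P u \<Longrightarrow> P v \<Longrightarrow> P (lin_comb a u c v)"
    and inv: "\<And>s u. s \<in> S \<Longrightarrow> P u \<Longrightarrow> P (reflect s u)"
    and "P v" "s \<in> S" "pairing v s \<noteq> 0" "t \<in> S"
  shows "P (simple_root t)"
proof -
  have step: "P (simple_root s)" if "P v" "s \<in> S" "pairing v s \<noteq> 0" for v s
  proof -
    have "simple_root s = lin_comb (1 / (2 * pairing v s)) v (- 1 / (2 * pairing v s)) (reflect s v)"
      using that(3) by (auto simp: lin_comb_def reflect_def field_simps)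
    then show ?thesis using lin inv that by metis
  qed
  have "{t \<in> S. P (simple_root t)} = S"
  proof (rule connected)
    show "{t \<in> S. P (simple_root t)} \<noteq> {}" using step assms by blast
    show "t \<in> {t \<in> S. P (simple_root t)}"
      if "s \<in> {t \<in> S. P (simple_root t)}" "t \<in> S" "b s t \<noteq> 0" for s t
      using step[of "simple_root s" t] that by auto
  qed auto
  then show ?thesis using assms by blast
qed

text \<open>Given by coordinates rather than as \<open>form w\<close>, since a degenerate form does
  not represent every functional.\<close>

definition functional :: "('a \<Rightarrow> real) \<Rightarrow> ('a \<Rightarrow> real) \<Rightarrow> real" where
  "functional f v = (\<Sum>s\<in>S. f s * v s)"

lemma functional_lin_comb: "functional f (lin_comb a u c v) = a * functional f u + c * functional f v"
  by (simp add: functional_def lin_comb_def sum_distrib_left distrib_left sum.distrib mult_ac)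

lemma functional_simple_root: "s \<in> S \<Longrightarrow> functional f (simple_root s) = f s"
  using finite_S by (simp add: functional_def simple_root_def of_bool_def if_distrib cong: if_cong)

text \<open>The vectors whose orbit is annihilated by \<open>f\<close> form a proper invariant subspace, and
  such a subspace lies in the radical.\<close>

lemma core_trivial_mod_radical:
  assumes H: "\<And>h v. h \<in> H \<Longrightarrow> functional f (T h v) = functional f v"
    and f: "x \<in> S" "f x \<noteq> 0"
    and n: "n \<in> carrier G" "\<And>g. g \<in> carrier G \<Longrightarrow> g \<otimes> n \<otimes> inv g \<in> H"
    and "s \<in> S"
  shows "pairing (T n v) s = pairing v s"
proof (rule ccontr)
  assume neq: "pairing (T n v) s \<noteq> pairing v s"
  define P where "P = (\<lambda>v. \<forall>g\<in>carrier G. functional f (T g v) = 0)"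
  have "P (simple_root x)"
  proof (rule invariant_subspace_contains_simple_roots)
    show "P (lin_comb a u c v)" if "P u" "P v" for a u c v
      using that by (simp add: P_def T_lin_comb functional_lin_comb)
    show "P (reflect s u)" if "s \<in> S" "P u" for s u
      unfolding P_def
    proof
      fix g assume "g \<in> carrier G"
      then have "g \<otimes> s \<in> carrier G" "T g (reflect s u) = T (g \<otimes> s) u"
        using that S_carrier by (auto simp: T_mult T_simple subset_eq)
      then show "functional f (T g (reflect s u)) = 0" using that by (simp add: P_def)
    qed
    show "P (lin_comb 1 (T n v) (-1) v)"
      unfolding P_def
    proof
      fix g assume g: "g \<in> carrier G"
      have "T (g \<otimes> n \<otimes> inv g) (T g v) = T g (T n v)"
        using g n(1) by (simp add: T_mult)
      then have "functional f (T g (T n v)) = functional f (T g v)" using H n(2)[OF g] by metis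
      then show "functional f (T g (lin_comb 1 (T n v) (-1) v)) = 0"
        using g by (simp add: T_lin_comb functional_lin_comb)
    qed
    show "pairing (lin_comb 1 (T n v) (-1) v) s \<noteq> 0" using neq by simp
  qed (use assms in auto)
  then have "functional f (T \<one> (simple_root x)) = 0" by (simp add: P_def)
  then show False using f by (simp add: T_one functional_simple_root)
qed

text \<open>If the root orbits are finite modulo the radical, then summing the squares of the
  functionals they define gives an invariant positive semidefinite form; by connectedness it is
  a positive multiple of \<open>form\<close>.\<close>

lemma form_nonneg_of_finite_orbits:
  assumes fin: "\<And>s. s \<in> S \<Longrightarrow> finite ((\<lambda>g. form (T g (simple_root s))) ` carrier G)"
  shows "form v v \<ge> 0"
proof (cases "S = {}")
  case True then show ?thesis by (subst form_def) simp
next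
  case False
  then obtain z where z: "z \<in> S" by blast
  \<comment> \<open>The distinct functionals are summed rather than the group elements, which may be
    infinitely many.\<close>
  define \<Phi> where "\<Phi> = (\<Union>s\<in>S. (\<lambda>g. form (T g (simple_root s))) ` carrier G)"
  have fin\<Phi>: "finite \<Phi>" using fin finite_S by (auto simp: \<Phi>_def)
  define Q where "Q = (\<lambda>u v. \<Sum>\<phi>\<in>\<Phi>. \<phi> u * \<phi> v)"
  have \<Phi>E: "\<exists>w. \<phi> = form w" if "\<phi> \<in> \<Phi>" for \<phi> using that by (auto simp: \<Phi>_def)
  have \<Phi>_reflect: "\<phi> \<circ> reflect s \<in> \<Phi>" if "\<phi> \<in> \<Phi>" "s \<in> S" for \<phi> s
  proof -
    from that obtain g t where g: "g \<in> carrier G" "t \<in> S" "\<phi> = form (T g (simple_root t))"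
      by (auto simp: \<Phi>_def)
    have s: "s \<in> carrier G" using that S_carrier by auto
    have "\<phi> \<circ> reflect s = form (T (inv s \<otimes> g) (simple_root t))"
      using g s that(2) T_form_left[of "inv s"] by (auto simp: T_mult T_simple fun_eq_iff)
    then show ?thesis using g s by (auto simp: \<Phi>_def)
  qed
  have Q_sym: "Q u v = Q v u" for u v by (simp add: Q_def mult.commute)
  have Q_reflect: "Q (reflect s u) (reflect s v) = Q u v" if "s \<in> S" for s u v
    unfolding Q_def
    by (rule sum.reindex_bij_witness[of _ "\<lambda>\<phi>. \<phi> \<circ> reflect s" "\<lambda>\<phi>. \<phi> \<circ> reflect s"])
      (use that in \<open>auto simp: \<Phi>_reflect reflect_reflect fun_eq_iff\<close>)
  have Q_lin: "Q u (lin_comb a w c v) = a * Q u w + c * Q u v" for u a w c v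
  proof -
    have "Q u (lin_comb a w c v) = (\<Sum>\<phi>\<in>\<Phi>. a * (\<phi> u * \<phi> w) + c * (\<phi> u * \<phi> v))"
      unfolding Q_def by (rule sum.cong) (auto dest!: \<Phi>E simp: algebra_simps)
    then show ?thesis by (simp add: Q_def sum.distrib sum_distrib_left)
  qed
  \<comment> \<open>\<open>reflect s\<close> negates its root and preserves \<open>Q\<close>;
    comparing both sides leaves a multiple of \<open>pairing v s\<close>.\<close>
  have Q_simple: "Q (simple_root s) v = pairing v s * Q (simple_root s) (simple_root s)"
    if "s \<in> S" for s v
  proof -
    have "Q (simple_root s) v = Q (reflect s v) (reflect s (simple_root s))"
      using Q_reflect[OF that] Q_sym by metis
    also have "\<dots> = - Q (simple_root s) (reflect s v)"
      unfolding reflect_simple_root_self[OF that] Q_lin using Q_sym by simp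
    also have "\<dots> = - Q (simple_root s) v + 2 * pairing v s * Q (simple_root s) (simple_root s)"
      by (simp add: reflect_def Q_lin)
    finally show ?thesis by simp
  qed
  define c where "c = Q (simple_root z) (simple_root z)"
  \<comment> \<open>For neighbours, computing \<open>Q\<close> of the two simple roots from either
    side equates the diagonal values.\<close>
  have all_c: "{s \<in> S. Q (simple_root s) (simple_root s) = c} = S"
  proof (rule connected)
    show "{s \<in> S. Q (simple_root s) (simple_root s) = c} \<noteq> {}" using z by (auto simp: c_def)
    fix s t assume *: "s \<in> {s \<in> S. Q (simple_root s) (simple_root s) = c}" "t \<in> S" "b s t \<noteq> 0"
    then show "t \<in> {s \<in> S. Q (simple_root s) (simple_root s) = c}"
      using Q_simple[of s "simple_root t"] Q_simple[of t "simple_root s"]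
        Q_sym[of "simple_root s" "simple_root t"] b_sym[of s t] by auto
  qed auto
  have Qc: "Q (simple_root s) v = c * pairing v s" if "s \<in> S" for s v
  proof -
    have "Q (simple_root s) (simple_root s) = c" using that all_c by blast
    then show ?thesis using Q_simple[OF that, of v] by simp
  qed
  have "Q v v = (\<Sum>\<phi>\<in>\<Phi>. \<Sum>s\<in>S. v s * (\<phi> (simple_root s) * \<phi> v))"
    unfolding Q_def
  proof (rule sum.cong)
    fix \<phi> assume "\<phi> \<in> \<Phi>"
    then obtain w where w: "\<phi> = form w" using \<Phi>E by blast
    have "\<phi> v = (\<Sum>s\<in>S. v s * \<phi> (simple_root s))"
      unfolding w by (subst form_def) (auto intro!: sum.cong)
    then show "\<phi> v * \<phi> v = (\<Sum>s\<in>S. v s * (\<phi> (simple_root s) * \<phi> v))"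
      by (simp add: sum_distrib_right mult.assoc)
  qed simp
  also have "\<dots> = (\<Sum>s\<in>S. v s * Q (simple_root s) v)"
    by (subst sum.swap) (simp add: Q_def sum_distrib_left)
  also have "\<dots> = c * form v v"
    by (simp add: Qc form_def sum_distrib_left mult_ac)
  finally have Qv: "Q v v = c * form v v" .
  have "form (simple_root z) \<in> \<Phi>"
    using z by (auto simp: \<Phi>_def T_one intro!: bexI[of _ z] image_eqI[of _ _ \<one>])
  then have "form (simple_root z) (simple_root z) * form (simple_root z) (simple_root z) \<le> c"
    unfolding c_def Q_def
    by (intro member_le_sum[of _ _ "\<lambda>\<phi>. \<phi> (simple_root z) * \<phi> (simple_root z)"]) (auto simp: fin\<Phi>)
  then have "c > 0" using z by (simp add: b_diag)
  moreover have "Q v v \<ge> 0" by (simp add: Q_def sum_nonneg)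
  ultimately show ?thesis using Qv by (simp add: zero_le_mult_iff)
qed

section \<open>Counting equations for a reflection subgroup of finite index\<close>

theorem card_simple_le_card_reflections:
  assumes inf: "infinite (carrier G)"
    and R: "R \<subseteq> reflections G S" "finite R"
    and index: "finite (rcosets (generate G R))"
  shows "card S \<le> card R"
proof (rule ccontr)
  assume "\<not> card S \<le> card R"
  then have card: "card R < card S" by simp
  define H where "H = generate G R"
  have RG: "R \<subseteq> carrier G" using R(1) S_carrier by (auto simp: reflections_def)
  have sub: "subgroup H G" unfolding H_def by (rule generate_is_subgroup[OF RG])
  have HG: "h \<in> carrier G" if "h \<in> H" for h using sub that by (rule subgroup.mem_carrier)
  have "\<exists>\<beta>. \<forall>v. T r v = lin_comb 1 v (- 2 * form v \<beta>) \<beta>" if "r \<in> R" for r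
  proof -
    have "r \<in> reflections G S" using that R(1) by blast
    then obtain g s where "g \<in> carrier G" "s \<in> S" "r = g \<otimes> s \<otimes> inv g"
      unfolding reflections_def by blast
    then show ?thesis using T_conjugate_simple by blast
  qed
  then obtain \<beta> where \<beta>: "\<And>r v. r \<in> R \<Longrightarrow> T r v = lin_comb 1 v (- 2 * form v (\<beta> r)) (\<beta> r)"
    by metis
  have H_inv: "functional f (T h v) = functional f v"
    if f: "\<And>r. r \<in> R \<Longrightarrow> functional f (\<beta> r) = 0" and h: "h \<in> H" for f h v
    using h unfolding H_def
  proof (induction h arbitrary: v rule: generate.induct)
    case (inv r)
    have "functional f (T r (T (inv r) v)) = functional f (T (inv r) v)"
      using f inv by (simp add: \<beta> functional_lin_comb)
    then show ?case using RG inv by auto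
  next
    case (eng h1 h2)
    then show ?case using HG by (simp add: T_mult H_def)
  qed (simp_all add: T_one \<beta> functional_lin_comb f)
  have H_fix: "T h u = u" if u: "\<And>r. r \<in> R \<Longrightarrow> form u (\<beta> r) = 0" and h: "h \<in> H" for u h
    using h unfolding H_def
  proof (induction h rule: generate.induct)
    case (incl r)
    then show ?case by (simp add: \<beta> u) (simp add: lin_comb_def)
  next
    case (inv r)
    have "T r u = u" using inv by (simp add: \<beta> u) (simp add: lin_comb_def)
    then show ?case using T_inv(2)[of r u] RG inv by auto
  next
    case (eng h1 h2)
    then show ?case using HG by (simp add: T_mult H_def)
  qed (simp add: T_one)
  define N where "N = {n \<in> carrier G. \<forall>g\<in>carrier G. g \<otimes> n \<otimes> inv g \<in> H}"
  obtain F :: "'a \<Rightarrow> 'a set \<Rightarrow> 'a set" where F: "finite (F ` carrier G)"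
    "\<And>g h k. \<lbrakk>g \<in> carrier G; h \<in> carrier G; k \<in> carrier G; F g = F h\<rbrakk>
       \<Longrightarrow> k \<otimes> (g \<otimes> inv h) \<otimes> inv k \<in> H"
    using finite_index_core_fibres[OF sub] index H_def by metis
  have FN: "g \<otimes> inv h \<in> N" if "g \<in> carrier G" "h \<in> carrier G" "F g = F h" for g h
    using F(2) that by (auto simp: N_def)
  \<comment> \<open>Finitely many values on an infinite group: two elements collide, and their
    quotient is a nontrivial element of the core \<open>N\<close>.\<close>
  have "\<not> inj_on F (carrier G)" using F(1) inf finite_imageD by blast
  then obtain g h where gh: "g \<in> carrier G" "h \<in> carrier G" "F g = F h" "g \<noteq> h"
    by (auto simp: inj_on_def)
  define n where "n = g \<otimes> inv h"
  have n: "n \<in> N" "n \<in> carrier G" using FN gh by (auto simp: n_def)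
  have "n \<noteq> \<one>" using gh by (metis inv_equality inv_inv inv_closed n_def)
  then obtain z where z: "z \<in> S" "T n (simple_root z) \<noteq> simple_root z"
    using T_faithful n by blast
  define \<delta> where "\<delta> = lin_comb 1 (T n (simple_root z)) (-1) (simple_root z)"
  obtain f where f: "\<exists>s\<in>S. f s \<noteq> 0" "\<And>r. r \<in> R \<Longrightarrow> (\<Sum>s\<in>S. \<beta> r s * f s) = 0"
    using homogeneous_system_nonzero_solution[OF R(2) finite_S card, of \<beta>] by blast
  have f': "functional f (\<beta> r) = 0" if "r \<in> R" for r using f(2)[OF that] by (simp add: functional_def mult.commute)
  have N_rad: "pairing (T k v) s = pairing v s" if "k \<in> N" "s \<in> S" for k v s
    using core_trivial_mod_radical[of H f _ k s v] H_inv[OF f'] f(1) that unfolding N_def by blast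
  have psd: "form v v \<ge> 0" for v
  proof (rule form_nonneg_of_finite_orbits)
    fix s assume "s \<in> S"
    \<comment> \<open>Equal \<open>F\<close> means a difference by the core, which acts trivially
      modulo the radical, and \<open>form\<close> does not see the radical.\<close>
    have "form (T g (simple_root s)) = form (T h (simple_root s))"
      if "g \<in> carrier G" "h \<in> carrier G" "F g = F h" for g h
    proof -
      have "T g (simple_root s) = T (g \<otimes> inv h) (T h (simple_root s))"
        using that by (simp add: T_mult)
      then have "pairing (T g (simple_root s)) t = pairing (T h (simple_root s)) t" if "t \<in> S" for t
        using N_rad[OF FN] that \<open>g \<in> _\<close> \<open>h \<in> _\<close> \<open>F g = F h\<close> by simp
      then show ?thesis by (auto simp: form_def fun_eq_iff)
    qed
    with F(1) show "finite ((\<lambda>g. form (T g (simple_root s))) ` carrier G)"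
      by (rule finite_image_factor)
  qed
  have \<delta>_rad: "pairing \<delta> s = 0" if "s \<in> S" for s using N_rad[OF n(1) that] by (simp add: \<delta>_def)
  obtain x where x: "T n (simple_root z) x \<noteq> simple_root z x" using z(2) by auto
  then have "x \<in> S" using T_outside n(2) by blast
  then have \<delta>z: "\<delta> z \<noteq> 0"
    using radical_coordinates_nonzero[OF psd \<delta>_rad, of x z] x z(1) by (simp add: \<delta>_def lin_comb_def)
  \<comment> \<open>A rank-one term at \<open>z\<close> is added to B. On the radical vector
    \<open>\<delta>\<close> only that term survives, so invariance under \<open>n\<close> will give
    \<open>u z = 0\<close>.\<close>
  obtain u where u: "\<exists>s\<in>S. u s \<noteq> 0"
    "\<And>r. r \<in> R \<Longrightarrow> (\<Sum>s\<in>S. (pairing (\<beta> r) s + of_bool (s = z) * \<beta> r z) * u s) = 0"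
    using homogeneous_system_nonzero_solution[OF R(2) finite_S card,
        of "\<lambda>r s. pairing (\<beta> r) s + of_bool (s = z) * \<beta> r z"] by blast
  have u\<beta>: "form u (\<beta> r) + u z * \<beta> r z = 0" if "r \<in> R" for r
  proof -
    have "(\<Sum>s\<in>S. of_bool (s = z) * \<beta> r z * u s) = \<beta> r z * u z"
      using z(1) finite_S by (simp add: of_bool_def if_distrib if_distribR cong: if_cong)
    moreover have "form u (\<beta> r) = (\<Sum>s\<in>S. pairing (\<beta> r) s * u s)"
      by (subst form_sym) (rule form_def)
    ultimately show ?thesis using u(2)[OF that]
      by (simp add: distrib_right sum.distrib mult.commute[of "u z"])
  qed
  define k where "k = (\<lambda>s. pairing u s + of_bool (s = z) * u z)"
  have k: "functional k v = form u v + u z * v z" for v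
  proof -
    have "(\<Sum>s\<in>S. of_bool (s = z) * u z * v s) = u z * v z"
      using z(1) finite_S by (simp add: of_bool_def if_distrib if_distribR cong: if_cong)
    then show ?thesis by (simp add: k_def functional_def form_def distrib_right sum.distrib)
  qed
  have "n \<in> H" using n unfolding N_def by (auto dest: bspec[of _ _ \<one>])
  then have "functional k \<delta> = 0" using H_inv[of k n "simple_root z"] u\<beta> k by (simp add: \<delta>_def functional_lin_comb)
  moreover have "form u \<delta> = 0" by (subst form_sym) (simp add: form_def \<delta>_rad)
  ultimately have uz: "u z = 0" using \<delta>z k by simp
  then have N_u: "T m u = u" if "m \<in> H" for m using H_fix[of u m] u\<beta> that by simp
  \<comment> \<open>By Perron--Frobenius \<open>u\<close> is outside the radical, as it vanishes at
    \<open>z\<close> but not everywhere on \<open>S\<close>.\<close>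
  obtain s where s: "s \<in> S" "pairing u s \<noteq> 0"
    using radical_coordinates_nonzero[OF psd, of u _ z] u(1) z(1) uz by metis
  define P where "P = (\<lambda>v. \<forall>m\<in>N. T m v = v)"
  have "P (simple_root z)"
  proof (rule invariant_subspace_contains_simple_roots)
    show "P (lin_comb a u c v)" if "P u" "P v" for a u c v
      using that by (auto simp: P_def N_def T_lin_comb)
    show "P (reflect s v)" if "s \<in> S" "P v" for s v
      unfolding P_def
    proof
      fix m assume m: "m \<in> N"
      have sG: "s \<in> carrier G" and mG: "m \<in> carrier G" using that m S_carrier by (auto simp: N_def)
      \<comment> \<open>Normality of the core makes its fixed vectors stable under
        \<open>reflect s\<close>.\<close>
      have "inv s \<otimes> m \<otimes> s \<in> N"
        unfolding N_def
      proof (intro CollectI conjI ballI)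
        fix g assume g: "g \<in> carrier G"
        have "(g \<otimes> inv s) \<otimes> m \<otimes> inv (g \<otimes> inv s) \<in> H" using m g sG by (auto simp: N_def)
        then show "g \<otimes> (inv s \<otimes> m \<otimes> s) \<otimes> inv g \<in> H"
          using g sG mG by (simp add: inv_mult_group m_assoc)
      qed (use sG mG in auto)
      then have "T s (T (inv s \<otimes> m \<otimes> s) v) = T s v" using that by (simp add: P_def)
      then have "T m (T s v) = T s v" using sG mG by (simp add: T_mult)
      then show "T m (reflect s v) = reflect s v" using that by (simp add: T_simple)
    qed
    show "P u" unfolding P_def N_def using N_u by (auto dest: bspec[of _ _ \<one>])
  qed (use s z in auto)
  then show False using z n by (auto simp: P_def)
qed

end

section \<open>Faithfulness\<close>

fun alternating :: "nat \<Rightarrow> 'a \<Rightarrow> 'a \<Rightarrow> 'a list" where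
  "alternating 0 s t = []"
| "alternating (Suc k) s t = alternating k t s @ [t]"

lemma alternating_Cons:
  "alternating (Suc k) s t = (if even k then t else s) # alternating k s t"
  by (induction k arbitrary: s t) auto

lemma length_alternating [simp]: "length (alternating k s t) = k"
  by (induction k arbitrary: s t) auto

lemma set_alternating: "set (alternating k s t) \<subseteq> {s, t}"
  by (induction k arbitrary: s t) auto

lemma alternating_add:
  "alternating (j + k) s t
     = (if even k then alternating j s t else alternating j t s) @ alternating k s t"
  by (induction k arbitrary: s t) auto

lemma rev_alternating:
  "rev (alternating k s t) = (if even k then alternating k t s else alternating k s t)"
proof (induction k arbitrary: s t)
  case (Suc k)
  then show ?case using alternating_Cons[of k s t] alternating_Cons[of k t s] by auto
qed simp

lemma concat_replicate_alternating: "concat (replicate k [s, t]) = alternating (2 * k) s t"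
  by (induction k) (auto simp: alternating_Cons simp del: alternating.simps(2))

text \<open>\<open>chebyshev q k\<close> is \<open>U\<^sub>k\<^sub>-\<^sub>1 (q / 2)\<close> for the Chebyshev polynomials of the second kind; these
  are the coordinates of the roots of a dihedral group.\<close>

fun chebyshev :: "real \<Rightarrow> nat \<Rightarrow> real" where
  "chebyshev q 0 = 0"
| "chebyshev q (Suc 0) = 1"
| "chebyshev q (Suc (Suc k)) = q * chebyshev q (Suc k) - chebyshev q k"

lemma chebyshev_2: "chebyshev 2 k = real k"
  by (induction "2::real" k rule: chebyshev.induct) auto

text \<open>Both sides obey the recurrence sin((k+2)\<theta>) + sin(k\<theta>) = 2 cos(\<theta>)
  sin((k+1)\<theta>).\<close>

lemma sin_chebyshev: "sin \<theta> * chebyshev (2 * cos \<theta>) k = sin (real k * \<theta>)"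
proof (induction "2 * cos \<theta>" k rule: chebyshev.induct)
  case (3 k)
  have "sin (real (Suc (Suc k)) * \<theta>) = sin (real (Suc k) * \<theta> + \<theta>)"
    "sin (real k * \<theta>) = sin (real (Suc k) * \<theta> - \<theta>)"
    by (simp_all add: algebra_simps)
  then have "sin (real (Suc (Suc k)) * \<theta>) = 2 * cos \<theta> * sin (real (Suc k) * \<theta>) - sin (real k * \<theta>)"
    unfolding sin_add sin_diff by simp
  also have "\<dots> = 2 * cos \<theta> * (sin \<theta> * chebyshev (2 * cos \<theta>) (Suc k)) - sin \<theta> * chebyshev (2 * cos \<theta>) k"
    using 3 by simp
  finally show ?case by (simp add: algebra_simps)
qed simp_all

section \<open>Words acting by simple reflections, and the dihedral relations\<close>

context coxeter_form
begin

text \<open>Defined on words, where no relation has to be checked; it descends to the group by the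
  presentation.\<close>

definition act :: "'a list \<Rightarrow> ('a \<Rightarrow> real) \<Rightarrow> 'a \<Rightarrow> real" where
  "act w v = foldr reflect w v"

lemma act_simps [simp]: "act [] v = v" "act (s # w) v = reflect s (act w v)"
  "act (u @ w) v = act u (act w v)"
  by (simp_all add: act_def)

lemma act_lin_comb: "act w (lin_comb a u c v) = lin_comb a (act w u) c (act w v)"
  by (induction w) (auto simp: reflect_lin_comb)

lemma act_form: "w \<in> lists S \<Longrightarrow> form (act w u) (act w v) = form u v"
  by (induction w) (auto simp: form_reflect)

lemma act_outside: "w \<in> lists S \<Longrightarrow> x \<notin> S \<Longrightarrow> act w v x = v x"
  by (induction w) (auto simp: reflect_outside)

text \<open>Prepending a letter reflects within the plane of the two simple roots. This changes one
  coordinate x, beside the other coordinate y, to \<open>- 2 * b s t * y - x\<close>: the Chebyshev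
  recurrence.\<close>

lemma act_alternating:
  assumes st: "s \<in> S" "t \<in> S"
  defines "c \<equiv> chebyshev (- 2 * b s t)"
  shows "act (alternating k s t) (simple_root s)
    = (if even k then lin_comb (c (Suc k)) (simple_root s) (c k) (simple_root t)
       else lin_comb (c k) (simple_root s) (c (Suc k)) (simple_root t))"
proof (induction k)
  case 0
  then show ?case by (simp add: c_def lin_comb_def)
next
  case (Suc k)
  have c: "c (Suc (Suc k)) = - 2 * b s t * c (Suc k) - c k" by (simp add: c_def)
  show ?case
    unfolding alternating_Cons act_simps Suc
    using st b_sym[of s t]
    by (auto simp: reflect_def b_diag c) (auto simp: lin_comb_def algebra_simps)
qed

text \<open>The form is nondegenerate on the plane of the two simple roots, as sin(\<theta>) is
  nonzero. Hence \<open>v\<close> splits into a vector of the plane and one orthogonal to it, and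
  the word fixes both.\<close>

lemma act_dihedral_relation:
  assumes st: "s \<in> S" "t \<in> S" and k: "k \<ge> 2" and b: "b s t = - cos (pi / real k)"
  shows "act (alternating (2 * k) s t) v = v"
proof -
  define \<theta> where "\<theta> = pi / real k"
  have "0 < \<theta>" "\<theta> < pi" using k by (auto simp: \<theta>_def field_simps)
  then have sin: "sin \<theta> > 0" by (rule sin_gt_zero)
  have k\<theta>: "real k * \<theta> = pi" using k by (simp add: \<theta>_def)
  let ?c = "chebyshev (2 * cos \<theta>)"
  have "real (2 * k) * \<theta> = 2 * pi" using k\<theta> by simp
  then have "sin \<theta> * ?c (2 * k) = 0" by (simp only: sin_chebyshev) simp
  then have c0: "?c (2 * k) = 0" using sin by simp
  have "real (Suc (2 * k)) * \<theta> = \<theta> + 2 * pi" using k\<theta> by (simp add: algebra_simps)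
  then have "sin \<theta> * ?c (Suc (2 * k)) = sin \<theta>" by (simp only: sin_chebyshev) simp
  then have c1: "?c (Suc (2 * k)) = 1" using sin by simp
  have Suc: "Suc (2 * k - 1) = 2 * k" using k by simp
  have "?c (Suc (Suc (2 * k - 1))) = 2 * cos \<theta> * ?c (Suc (2 * k - 1)) - ?c (2 * k - 1)" by simp
  then have c2: "?c (2 * k - 1) = - 1" unfolding Suc using c0 c1 by simp
  have q: "- 2 * b s t = 2 * cos \<theta>" "- 2 * b t s = 2 * cos \<theta>"
    using b b_sym[OF st] by (simp_all add: \<theta>_def)
  have act_s: "act (alternating (2 * k) s t) (simple_root s) = simple_root s"
    using act_alternating[OF st, of "2 * k"] unfolding q by (simp add: c0 c1 lin_comb_def)
  have "alternating (2 * k) s t = alternating (2 * k - 1) t s @ [t]"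
    using alternating.simps(2)[of "2 * k - 1" s t] Suc by simp
  then have "act (alternating (2 * k) s t) (simple_root t)
      = lin_comb (-1) (act (alternating (2 * k - 1) t s) (simple_root t)) 0
          (act (alternating (2 * k - 1) t s) (simple_root t))"
    using st by (simp add: reflect_simple_root_self act_lin_comb)
  also have "act (alternating (2 * k - 1) t s) (simple_root t)
      = lin_comb (-1) (simple_root t) 0 (simple_root s)"
    using act_alternating[OF st(2,1), of "2 * k - 1"] k unfolding q Suc by (simp add: c0 c2[unfolded One_nat_def])
  finally have act_t: "act (alternating (2 * k) s t) (simple_root t) = simple_root t"
    by (simp add: lin_comb_def)
  \<comment> \<open>Cramer's rule for the Gram matrix of the two simple roots, whose determinant is
    \<open>(sin \<theta>)\<^sup>2\<close>.\<close>
  define x where "x = (pairing v s + cos \<theta> * pairing v t) / (sin \<theta>)\<^sup>2"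
  define y where "y = (pairing v t + cos \<theta> * pairing v s) / (sin \<theta>)\<^sup>2"
  define p where "p = lin_comb x (simple_root s) y (simple_root t)"
  define r where "r = lin_comb 1 v (-1) p"
  have bst: "b s t = - cos \<theta>" "b t s = - cos \<theta>" using q by simp_all
  have sin2: "(sin \<theta>)\<^sup>2 = 1 - cos \<theta> * cos \<theta>" by (simp add: sin_squared_eq flip: power2_eq_square)
  have xy: "(sin \<theta>)\<^sup>2 * x = pairing v s + cos \<theta> * pairing v t"
    "(sin \<theta>)\<^sup>2 * y = pairing v t + cos \<theta> * pairing v s"
    using sin by (simp_all add: x_def y_def)
  have "(sin \<theta>)\<^sup>2 * (x - y * cos \<theta>) = (sin \<theta>)\<^sup>2 * x - cos \<theta> * ((sin \<theta>)\<^sup>2 * y)"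
    "(sin \<theta>)\<^sup>2 * (y - x * cos \<theta>) = (sin \<theta>)\<^sup>2 * y - cos \<theta> * ((sin \<theta>)\<^sup>2 * x)"
    by (simp_all add: algebra_simps)
  then have "(sin \<theta>)\<^sup>2 * (x - y * cos \<theta>) = (sin \<theta>)\<^sup>2 * pairing v s"
    "(sin \<theta>)\<^sup>2 * (y - x * cos \<theta>) = (sin \<theta>)\<^sup>2 * pairing v t"
    unfolding xy by (simp_all add: sin2 algebra_simps)
  then have "x - y * cos \<theta> = pairing v s" "y - x * cos \<theta> = pairing v t"
    using sin by simp_all
  then have "pairing r s = 0" "pairing r t = 0"
    using st by (simp_all add: r_def p_def bst b_diag)
  then have "reflect s r = r" "reflect t r = r"
    by (simp_all add: reflect_def lin_comb_def)
  then have "act w r = r" if "set w \<subseteq> {s, t}" for w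
    using that by (induction w) auto
  then have act_r: "act (alternating (2 * k) s t) r = r" using set_alternating by metis
  have v: "v = lin_comb 1 r 1 p" by (simp add: r_def lin_comb_def)
  show ?thesis
    by (subst (1 2) v) (simp add: act_lin_comb act_r p_def act_s act_t)
qed

end

text \<open>The canonical form of Tits; the value -1 for the code 0 is the limit of -cos(pi/m) as m
  tends to infinity.\<close>

definition coxeter_gram :: "('a \<Rightarrow> 'a \<Rightarrow> nat) \<Rightarrow> 'a \<Rightarrow> 'a \<Rightarrow> real" where
  "coxeter_gram m s t =
     (if s = t then 1 else if m s t = 0 then - 1 else - cos (pi / real (m s t)))"

locale coxeter_matrix =
  fixes S :: "'a set" and m :: "'a \<Rightarrow> 'a \<Rightarrow> nat"
  assumes finite_generators: "finite S"
    and m_diag: "s \<in> S \<Longrightarrow> m s s = 1"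
    and m_sym: "s \<in> S \<Longrightarrow> t \<in> S \<Longrightarrow> m s t = m t s"
    and m_neq_1: "s \<in> S \<Longrightarrow> t \<in> S \<Longrightarrow> s \<noteq> t \<Longrightarrow> m s t \<noteq> 1"

sublocale coxeter_matrix \<subseteq> coxeter_form S "coxeter_gram m"
proof
  fix s t assume st: "s \<in> S" "t \<in> S"
  show "coxeter_gram m s t = coxeter_gram m t s" using m_sym[OF st] by (simp add: coxeter_gram_def)
  assume "s \<noteq> t"
  then have "m s t = 0 \<or> m s t \<ge> 2" using m_neq_1[OF st] by linarith
  moreover have "cos (pi / real (m s t)) \<ge> 0" if "m s t \<ge> 2"
  proof (rule cos_ge_zero)
    have "0 \<le> pi / real (m s t)" by simp
    then show "- (pi / 2) \<le> pi / real (m s t)" using pi_ge_zero by linarith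
    show "pi / real (m s t) \<le> pi / 2" using that by (intro divide_left_mono) auto
  qed
  ultimately show "coxeter_gram m s t \<le> 0" using \<open>s \<noteq> t\<close> by (auto simp: coxeter_gram_def)
qed (auto simp: finite_generators coxeter_gram_def)

context coxeter_matrix
begin

lemma act_relation:
  assumes st: "s \<in> S" "t \<in> S" and "m s t \<noteq> 0"
  shows "act (concat (replicate (m s t) [s, t])) v = v"
proof (cases "s = t")
  case True
  then show ?thesis using st by (simp add: m_diag reflect_reflect)
next
  case False
  then have "m s t \<ge> 2" using assms m_neq_1[OF st] by linarith
  then show ?thesis
    using False unfolding concat_replicate_alternating
    by (intro act_dihedral_relation st) (auto simp: coxeter_gram_def)
qed

lemma cox_equiv_act: "cox_equiv m S u w \<Longrightarrow> act u v = act w v"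
proof (induction arbitrary: v rule: cox_equiv.induct)
  case (rel s t u w)
  then show ?case using act_relation by (simp del: concat_replicate_trivial)
qed auto

lemma cox_equiv_parity: "cox_equiv m S u w \<Longrightarrow> even (length u) = even (length w)"
  by (induction rule: cox_equiv.induct) (auto simp: concat_replicate_alternating)

text \<open>Up to a positive factor the value is sin(j\<theta>) with \<theta> = pi/m, and j \<le> m
  keeps the angle in [0, pi]. For infinite m the value is j.\<close>

lemma chebyshev_gram_nonneg:
  assumes st: "s \<in> S" "t \<in> S" "s \<noteq> t" and j: "m s t = 0 \<or> j \<le> m s t"
  shows "chebyshev (- 2 * coxeter_gram m s t) j \<ge> 0"
proof (cases "m s t = 0")
  case True
  then show ?thesis using st by (simp add: coxeter_gram_def chebyshev_2)
next
  case False
  define \<theta> where "\<theta> = pi / real (m s t)"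
  have m2: "m s t \<ge> 2" using False m_neq_1[OF st] by linarith
  then have "0 < \<theta>" "\<theta> < pi" by (auto simp: \<theta>_def field_simps)
  then have sin: "sin \<theta> > 0" by (rule sin_gt_zero)
  have "real j * \<theta> \<le> real (m s t) * \<theta>"
    using j False \<open>0 < \<theta>\<close> by (intro mult_right_mono) auto
  also have "\<dots> = pi" using False by (simp add: \<theta>_def)
  finally have "sin (real j * \<theta>) \<ge> 0" using \<open>0 < \<theta>\<close> by (intro sin_ge_zero) auto
  then have "sin \<theta> * chebyshev (2 * cos \<theta>) j \<ge> 0" by (simp add: sin_chebyshev)
  then show ?thesis using sin False st by (simp add: zero_le_mult_iff coxeter_gram_def \<theta>_def)
qed

end

section \<open>Reduced words and faithfulness of the action\<close>

locale coxeter_group = group G + coxeter_matrix S m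
  for G :: "('a, 'c) monoid_scheme" (structure) and S :: "'a set" and m +
  assumes generators_carrier: "S \<subseteq> carrier G"
    and generators_generate: "generate G S = carrier G"
    and relations: "s \<in> S \<Longrightarrow> t \<in> S \<Longrightarrow> m s t \<noteq> 0 \<Longrightarrow> (s \<otimes> t) [^] m s t = \<one>"
    and presentation: "w \<in> lists S \<Longrightarrow> word_eval G w = \<one> \<Longrightarrow> cox_equiv m S w []"
begin

lemma generator_closed [simp]: "s \<in> S \<Longrightarrow> s \<in> carrier G"
  using generators_carrier by blast

lemma generator_square [simp]: "s \<in> S \<Longrightarrow> s \<otimes> s = \<one>"
  using relations[of s s] by (simp add: m_diag)

lemma generator_inv [simp]: "s \<in> S \<Longrightarrow> inv s = s"
  by (simp add: inv_equality)

lemma word_eval_simps [simp]: "word_eval G [] = \<one>" "word_eval G (s # w) = s \<otimes> word_eval G w"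
  by (simp_all add: word_eval_def)

lemma word_eval_closed [simp]: "w \<in> lists S \<Longrightarrow> word_eval G w \<in> carrier G"
  by (induction w) auto

lemma word_eval_append [simp]:
  "u \<in> lists S \<Longrightarrow> w \<in> lists S \<Longrightarrow> word_eval G (u @ w) = word_eval G u \<otimes> word_eval G w"
  by (induction u) (auto simp: m_assoc)

lemma word_eval_rev: "w \<in> lists S \<Longrightarrow> word_eval G (rev w) = inv (word_eval G w)"
  by (induction w) (auto simp: inv_mult_group in_lists_conv_set)

lemma word_exists:
  assumes "g \<in> carrier G" obtains w where "w \<in> lists S" "word_eval G w = g"
proof -
  have "g \<in> generate G S" using assms generators_generate by simp
  then have "\<exists>w\<in>lists S. word_eval G w = g"
  proof (induction rule: generate.induct)
    case one
    show ?case by (intro bexI[of _ "[]"]) auto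
  next
    case (incl s)
    then show ?case by (intro bexI[of _ "[s]"]) auto
  next
    case (inv s)
    then show ?case by (intro bexI[of _ "[s]"]) auto
  next
    case (eng g h)
    then obtain u w where "u \<in> lists S" "word_eval G u = g" "w \<in> lists S" "word_eval G w = h" by blast
    then show ?case by (intro bexI[of _ "u @ w"]) auto
  qed
  then show ?thesis using that by blast
qed

text \<open>The presentation speaks only of words with value 1; reversal inverts a word because the
  generators are involutions.\<close>

lemma word_eval_eq_cox_equiv:
  assumes "u \<in> lists S" "w \<in> lists S" "word_eval G u = word_eval G w"
  shows "cox_equiv m S (u @ rev w) []"
proof (rule presentation)
  have "rev w \<in> lists S" using assms(2) by auto
  then show "u @ rev w \<in> lists S" "word_eval G (u @ rev w) = \<one>"
    using assms by (auto simp: word_eval_rev)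
qed

lemma act_rev: "w \<in> lists S \<Longrightarrow> act (rev w) (act w v) = v"
  by (induction w arbitrary: v) (auto simp: reflect_reflect)

lemma act_cong:
  assumes "u \<in> lists S" "w \<in> lists S" "word_eval G u = word_eval G w"
  shows "act u v = act w v"
  using cox_equiv_act[OF word_eval_eq_cox_equiv[OF assms], of "act w v"] act_rev[OF assms(2)]
  by simp

lemma parity_cong:
  assumes "u \<in> lists S" "w \<in> lists S" "word_eval G u = word_eval G w"
  shows "even (length u) = even (length w)"
  using cox_equiv_parity[OF word_eval_eq_cox_equiv[OF assms]] by simp

definition rep :: "'a \<Rightarrow> ('a \<Rightarrow> real) \<Rightarrow> 'a \<Rightarrow> real" where
  "rep g = act (SOME w. w \<in> lists S \<and> word_eval G w = g)"

lemma rep_word_eval: "w \<in> lists S \<Longrightarrow> rep (word_eval G w) v = act w v"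
proof -
  assume w: "w \<in> lists S"
  define u where "u = (SOME u. u \<in> lists S \<and> word_eval G u = word_eval G w)"
  have "u \<in> lists S \<and> word_eval G u = word_eval G w"
    unfolding u_def by (rule someI[of _ w]) (use w in simp)
  then show ?thesis unfolding rep_def u_def[symmetric] using w act_cong by blast
qed

definition reduced :: "'a list \<Rightarrow> bool" where
  "reduced w \<longleftrightarrow> w \<in> lists S \<and>
     (\<forall>v\<in>lists S. word_eval G v = word_eval G w \<longrightarrow> length w \<le> length v)"

lemma reduced_exists:
  assumes "g \<in> carrier G" obtains w where "reduced w" "word_eval G w = g"
proof -
  obtain u where "u \<in> lists S \<and> word_eval G u = g" using word_exists[OF assms] by blast
  from ex_has_least_nat[of "\<lambda>u. u \<in> lists S \<and> word_eval G u = g", OF this, of length]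
  show ?thesis using that unfolding reduced_def by blast
qed

lemma reduced_appendD:
  assumes "reduced (u @ w)" shows "reduced u"
  unfolding reduced_def
proof (intro conjI ballI impI)
  show u: "u \<in> lists S" using assms by (auto simp: reduced_def)
  have w: "w \<in> lists S" using assms by (auto simp: reduced_def)
  fix v assume v: "v \<in> lists S" "word_eval G v = word_eval G u"
  then have "v @ w \<in> lists S" "word_eval G (v @ w) = word_eval G (u @ w)"
    using u w by auto
  then have "length (u @ w) \<le> length (v @ w)" using assms unfolding reduced_def by blast
  then show "length u \<le> length v" by simp
qed

text \<open>The relator is an alternating word of length \<open>2 * m s t\<close>; cut it in the
  middle. For even \<open>m s t\<close> the halves agree and reversal swaps the letters; for odd
  \<open>m s t\<close> the halves differ and each is its own reversal.\<close>

lemma word_eval_braid: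
  assumes st: "s \<in> S" "t \<in> S" and "m s t \<noteq> 0"
  shows "word_eval G (alternating (m s t) s t) = word_eval G (alternating (m s t) t s)"
proof -
  let ?k = "m s t"
  have lists: "alternating j s t \<in> lists S" "alternating j t s \<in> lists S" for j
    using st set_alternating[of j s t] set_alternating[of j t s] by auto
  have pow: "word_eval G (concat (replicate j [s, t])) = (s \<otimes> t) [^] j" for j
  proof (induction j)
    case (Suc j)
    have "(s \<otimes> t) [^] Suc j = (s \<otimes> t) \<otimes> (s \<otimes> t) [^] j" using st by (intro nat_pow_Suc2) auto
    then show ?case using Suc st by (simp add: m_assoc)
  qed simp
  have "word_eval G (alternating (?k + ?k) s t) = \<one>"
    using pow[of ?k] relations[OF assms] by (simp add: concat_replicate_alternating mult_2)
  then show ?thesis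
  proof (cases "even ?k")
    case True
    then have "word_eval G (alternating ?k s t) = inv (word_eval G (alternating ?k s t))"
      using \<open>word_eval G (alternating (?k + ?k) s t) = \<one>\<close> lists
      by (intro inv_equality[symmetric]) (simp_all add: alternating_add)
    also have "\<dots> = word_eval G (alternating ?k t s)"
      using True word_eval_rev[OF lists(1), of ?k] by (simp add: rev_alternating)
    finally show ?thesis .
  next
    case False
    then have "word_eval G (alternating ?k t s) = inv (word_eval G (alternating ?k s t))"
      using \<open>word_eval G (alternating (?k + ?k) s t) = \<one>\<close> lists
      by (intro inv_equality[symmetric]) (simp_all add: alternating_add)
    also have "\<dots> = word_eval G (alternating ?k s t)"
      using False word_eval_rev[OF lists(1), of ?k] by (simp add: rev_alternating)
    finally show ?thesis by simp
  qed
qed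

text \<open>Tits' argument: split off from \<open>w\<close> the longest possible suffix in the dihedral subgroup
  generated by \<open>s\<close> and the last letter \<open>t\<close>. The remaining prefix can be lengthened by both
  \<open>s\<close> and \<open>t\<close>, and the suffix maps \<open>simple_root s\<close> to a nonnegative combination of
  \<open>simple_root s\<close> and \<open>simple_root t\<close>.\<close>

lemma act_reduced_nonneg:
  assumes "reduced (w @ [s])"
  shows "0 \<le> act w (simple_root s) x"
  using assms
proof (induction w arbitrary: s x rule: measure_induct_rule[where f = length])
  case (less w)
  show ?case
  proof (cases w rule: rev_cases)
    case Nil
    then show ?thesis by (simp add: simple_root_def)
  next
    case (snoc w' t)
    have red: "length (w @ [s]) \<le> length v"
      if "v \<in> lists S" "word_eval G v = word_eval G (w @ [s])" for v
      using less.prems that unfolding reduced_def by blast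
    have "w @ [s] \<in> lists S" using less.prems unfolding reduced_def by blast
    then have S: "s \<in> S" "t \<in> S" "w \<in> lists S" "w' \<in> lists S" using snoc by auto
    have "s \<noteq> t"
    proof
      assume "s = t"
      then have "word_eval G w' = word_eval G (w @ [s])" using snoc S by (simp add: m_assoc)
      then show False using red[of w'] S snoc by simp
    qed
    have alt: "alternating j s t \<in> lists S" "alternating j t s \<in> lists S" for j
      using S set_alternating[of j s t] set_alternating[of j t s] by auto
    \<comment> \<open>Lengths of alternating suffixes that can be split off from \<open>w\<close> at
      no cost in length.\<close>
    define A where "A = (\<lambda>k. \<exists>v\<in>lists S. length v + k = length w \<and>
        word_eval G (v @ alternating k s t) = word_eval G w)"
    have "A 1" unfolding A_def using snoc S by (intro bexI[of _ w']) auto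
    moreover have "k \<le> length w" if "A k" for k using that by (auto simp: A_def)
    ultimately obtain k where k: "A k" "\<And>j. A j \<Longrightarrow> j \<le> k"
      by (metis GreatestI_nat Greatest_le_nat)
    have "k \<ge> 1" using k(2) \<open>A 1\<close> by blast
    obtain v where v: "v \<in> lists S" "length v + k = length w"
      "word_eval G (v @ alternating k s t) = word_eval G w"
      using k(1) by (auto simp: A_def)
    have "reduced w" using less.prems reduced_appendD by blast
    then have red_v: "reduced (v @ alternating k s t)"
      using v alt unfolding reduced_def by (auto simp del: word_eval_append)
    \<comment> \<open>\<open>z\<close> is the first letter of the alternating suffix,
      \<open>y\<close> the letter that would extend it on the left.\<close>
    define y where "y = (if even k then t else s)"
    define z where "z = (if even k then s else t)"
    have yz: "y \<in> S" "z \<in> S" "{s, t} = {y, z}" using S by (auto simp: y_def z_def)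
    have "alternating k s t = [z] @ alternating (k - 1) s t"
      using alternating_Cons[of "k - 1" s t] \<open>k \<ge> 1\<close> by (auto simp: z_def)
    then have red_z: "reduced (v @ [z])" using red_v reduced_appendD[of "v @ [z]"] by simp
    have red_y: "reduced (v @ [y])"
    proof (rule ccontr)
      assume "\<not> reduced (v @ [y])"
      then obtain u where u: "u \<in> lists S" "word_eval G u = word_eval G (v @ [y])"
        "length u < length (v @ [y])"
        using v(1) yz(1) unfolding reduced_def by (auto simp del: word_eval_append simp: not_le)
      \<comment> \<open>Parity rules out equal lengths, so \<open>y\<close> would shorten
        \<open>v\<close> by exactly one and could move into the suffix, against the maximality of
        \<open>k\<close>.\<close>
      have "even (length u) = even (length (v @ [y]))"
        using u v yz by (intro parity_cong) auto
      then have "length u \<noteq> length v" by auto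
      have uy: "word_eval G (u @ [y]) = word_eval G v" using u v yz by (simp add: m_assoc)
      moreover have "u @ [y] \<in> lists S" using u yz by simp
      ultimately have "length v \<le> length (u @ [y])"
        using reduced_appendD[OF red_v] unfolding reduced_def by blast
      then have len: "length u + 1 = length v" using u(3) \<open>length u \<noteq> length v\<close> by simp
      have "word_eval G (u @ alternating (Suc k) s t) = word_eval G ((u @ [y]) @ alternating k s t)"
        by (simp only: alternating_Cons y_def append_assoc append_Cons append_Nil)
      also have "\<dots> = word_eval G w"
        using uy u v yz alt
        by (subst word_eval_append) (auto simp del: word_eval_append simp: word_eval_append[symmetric])
      finally have "A (Suc k)" unfolding A_def using u(1) len v(2) by (intro bexI[of _ u]) auto
      then show False using k(2) by fastforce
    qed
    \<comment> \<open>Otherwise the braid relation would make the suffix end in \<open>s\<close>,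
      which cancels with the last letter of \<open>w @ [s]\<close>.\<close>
    have km: "m s t = 0 \<or> k < m s t"
    proof (rule ccontr)
      assume "\<not> (m s t = 0 \<or> k < m s t)"
      then have mk: "m s t \<noteq> 0" "m s t \<le> k" by auto
      define p where "p = (if even (m s t) then alternating (k - m s t) s t
                           else alternating (k - m s t) t s)"
      have p: "alternating k s t = p @ alternating (m s t) s t" "p \<in> lists S"
        "length p + m s t = k"
        using alternating_add[of "k - m s t" "m s t" s t] mk alt by (auto simp: p_def)
      obtain j where j: "m s t = Suc j" using mk(1) not0_implies_Suc by blast
      have "word_eval G (w @ [s])
          = word_eval G v \<otimes> (word_eval G p \<otimes> word_eval G (alternating (m s t) t s)) \<otimes> s"
        using v p S alt word_eval_braid[OF S(1,2) mk(1)] by simp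
      also have "\<dots> = word_eval G (v @ p @ alternating j s t)"
        using v p S alt by (simp add: j m_assoc)
      finally have "length (w @ [s]) \<le> length (v @ p @ alternating j s t)"
        by (intro red) (use v(1) p(2) alt in simp_all)
      then show False using p(3) v(2) j by simp
    qed
    have "reduced (v @ [s])" "reduced (v @ [t])" using red_y red_z
      by (auto simp: y_def z_def split: if_splits)
    moreover have "length v < length w" using v(2) \<open>k \<ge> 1\<close> by simp
    ultimately have pos: "act v (simple_root s) x \<ge> 0" "act v (simple_root t) x \<ge> 0"
      using less.IH by blast+
    have act_w: "act w (simple_root s) = act v (act (alternating k s t) (simple_root s))"
      using act_cong[of w "v @ alternating k s t"] v S alt by (auto simp del: word_eval_append)
    have "chebyshev (- 2 * coxeter_gram m s t) j \<ge> 0" if "j \<le> Suc k" for j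
      using km that by (intro chebyshev_gram_nonneg S \<open>s \<noteq> t\<close>) linarith
    then have "chebyshev (- 2 * coxeter_gram m s t) k \<ge> 0"
      "chebyshev (- 2 * coxeter_gram m s t) (Suc k) \<ge> 0" by simp_all
    with pos show ?thesis
      unfolding act_w act_alternating[OF S(1,2)]
      by (auto simp: act_lin_comb simp del: chebyshev.simps)
        (auto simp: lin_comb_def simp del: chebyshev.simps)
  qed
qed

text \<open>A reduced word ending in \<open>s\<close> sends the simple root of \<open>s\<close> to a
  vector with nonpositive coordinates, so only the empty word can fix all simple roots.\<close>

lemma rep_faithful:
  assumes "g \<in> carrier G" and fixed: "\<And>s. s \<in> S \<Longrightarrow> rep g (simple_root s) = simple_root s"
  shows "g = \<one>"
proof -
  obtain w where w: "reduced w" "word_eval G w = g" using reduced_exists[OF assms(1)] by blast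
  show ?thesis
  proof (cases w rule: rev_cases)
    case Nil
    then show ?thesis using w by simp
  next
    case (snoc u s)
    have wS: "w \<in> lists S" using w by (simp add: reduced_def)
    then have s: "s \<in> S" using snoc by simp
    have "act w (simple_root s) = simple_root s"
      using fixed[OF s] rep_word_eval[OF wS] w by simp
    then have "lin_comb (-1) (act u (simple_root s)) 0 (act u (simple_root s)) = simple_root s"
      using snoc s by (simp add: reflect_simple_root_self act_lin_comb)
    then have "- act u (simple_root s) s = 1"
      by (auto simp: lin_comb_def simple_root_def fun_eq_iff)
    moreover have "0 \<le> act u (simple_root s) s" using w(1) snoc by (intro act_reduced_nonneg) simp
    ultimately show ?thesis by simp
  qed
qed

lemma geometric_representation_rep:
  assumes "coxeter_indecomposable G S"
  shows "geometric_representation G S (coxeter_gram m) rep"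
proof unfold_locales
  fix C assume C: "C \<subseteq> S" "C \<noteq> {}" "\<And>s t. \<lbrakk>s \<in> C; t \<in> S; coxeter_gram m s t \<noteq> 0\<rbrakk> \<Longrightarrow> t \<in> C"
  \<comment> \<open>A vanishing entry forces \<open>m s t = 2\<close>, hence commuting generators; a
    set closed under neighbours thus commutes with its complement.\<close>
  have "s \<otimes> t = t \<otimes> s" if st: "s \<in> C" "t \<in> S - C" for s t
  proof -
    have S: "s \<in> S" "t \<in> S" "s \<noteq> t" using st C(1) by auto
    have zero: "coxeter_gram m s t = 0" using C(3) st by blast
    have "m s t = 2"
    proof (rule ccontr)
      assume "m s t \<noteq> 2"
      moreover have "m s t \<noteq> 0" using zero S by (auto simp: coxeter_gram_def split: if_splits)
      ultimately have "m s t > 2" using m_neq_1[OF S] by linarith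
      then have "cos (pi / real (m s t)) > 0"
        by (intro cos_gt_zero divide_strict_left_mono) auto
      then show False using zero S \<open>m s t \<noteq> 0\<close> by (simp add: coxeter_gram_def)
    qed
    then have "(s \<otimes> t) \<otimes> (s \<otimes> t) = \<one>" using relations[OF S(1,2)] S by (simp add: numeral_2_eq_2)
    then have "s \<otimes> t = inv (s \<otimes> t)" using S by (intro inv_equality[symmetric]) auto
    then show ?thesis using S by (simp add: inv_mult_group)
  qed
  then have "S - C = {}" using assms C(1,2) unfolding coxeter_indecomposable_def
    by (metis Diff_disjoint Un_Diff_cancel sup.absorb2)
  then show "C = S" using C(1) by blast
next
  fix v
  show "rep \<one> v = v" using rep_word_eval[of "[]" v] by simp
next
  fix g h v assume "g \<in> carrier G" "h \<in> carrier G"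
  then obtain u w where "u \<in> lists S" "word_eval G u = g" "w \<in> lists S" "word_eval G w = h"
    using word_exists by metis
  then show "rep (g \<otimes> h) v = rep g (rep h v)"
    using rep_word_eval[of "u @ w" v] rep_word_eval[of u] rep_word_eval[of w] by auto
next
  fix s v assume "s \<in> S"
  then show "rep s v = reflect s v" using rep_word_eval[of "[s]" v] by simp
next
  fix g a u c v assume "g \<in> carrier G"
  then show "rep g (lin_comb a u c v) = lin_comb a (rep g u) c (rep g v)"
    by (simp add: rep_def act_lin_comb)
next
  fix g u v assume "g \<in> carrier G"
  then show "form (rep g u) (rep g v) = form u v"
    using word_exists rep_word_eval act_form by metis
next
  fix g x v assume "g \<in> carrier G" "x \<notin> S"
  then show "rep g v x = v x"
    using word_exists rep_word_eval act_outside by metis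
qed (auto intro: rep_faithful)

end

section \<open>Passage from Coxeter systems to the representation\<close>

lemma coxeter_system_imp_coxeter_group:
  assumes "coxeter_system G S" "finite S"
  obtains m where "coxeter_group G S m"
proof -
  interpret group G using assms(1) by (simp add: coxeter_system_def)
  obtain m :: "'a \<Rightarrow> 'a \<Rightarrow> nat" where m:
    "\<forall>s\<in>S. m s s = 1" "\<forall>s\<in>S. \<forall>t\<in>S. s \<noteq> t \<longrightarrow> m s t = m t s \<and> m s t \<noteq> 1"
    "\<forall>s\<in>S. \<forall>t\<in>S. m s t \<noteq> 0 \<longrightarrow> (s \<otimes>\<^bsub>G\<^esub> t) [^]\<^bsub>G\<^esub> (m s t) = \<one>\<^bsub>G\<^esub>"
    "\<forall>w\<in>lists S. word_eval G w = \<one>\<^bsub>G\<^esub> \<longrightarrow> cox_equiv m S w []"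
    "S \<subseteq> carrier G" "generate G S = carrier G"
    using assms(1) unfolding coxeter_system_def by blast
  have "m s t = m t s" if "s \<in> S" "t \<in> S" for s t
    using m(2) that by (cases "s = t") auto
  then have "coxeter_group G S m"
    by unfold_locales (use m assms(2) in \<open>simp_all add: subset_eq\<close>)
  then show ?thesis by (rule that)
qed

theorem theorem1p2:
  fixes G :: "('a, 'b) monoid_scheme" and S H :: "'a set"
  assumes "coxeter_system G S"
    and "finite S"
    and "infinite (carrier G)"
    and "coxeter_indecomposable G S"
    and "reflection_subgroup G S H"
    and "finite (rcosets\<^bsub>G\<^esub> H)"
  shows "\<forall>R. R \<subseteq> reflections G S \<and> generate G R = H \<longrightarrow> infinite R \<or> card S \<le> card R"
proof -
  obtain m where "coxeter_group G S m"
    using coxeter_system_imp_coxeter_group[OF assms(1,2)] .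
  then interpret geometric_representation G S "coxeter_gram m" "coxeter_group.rep G S m"
    using assms(4) by (rule coxeter_group.geometric_representation_rep)
  show ?thesis using card_simple_le_card_reflections assms(3,6) by blast
qed

end
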